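(* Let $G$ be the $4$-regular graph with the seven vertices $x_1,x_2,x_3,y_1,y_2,y_3,y_4$ whose edges are $\{x_i,y_j\}$ for all $i\in\{1,2,3\}$, $j\in\{1,2,3,4\}$, together with $\{y_1,y_2\}$ and $\{y_3,y_4\}$. For $n\ge3$ let $G_n=G\times C_n$ be the Cartesian product of $G$ with the cycle $C_n$ on $n$ vertices. Then $(G_n)_{n\ge3}$ is an infinite family of finite $6$-regular graphs of increasing size, every $G_n$ satisfies $CD(0,\infty)$, and no $G_n$ is a Cayley graph.
   Context: For a locally finite simple graph $(V,E)$ and $f:V\to\mathbb R$ put $\Delta f(x)=\sum_{y\sim x}(f(y)-f(x))$ (non-normalized Laplacian), and for $f,g:V\to\mathbb R$ put $2\Gamma(f,g)=\Delta(fg)-f\Delta g-g\Delta f$, $2\Gamma_2(f,g)=\Delta\Gamma(f,g)-\Gamma(f,\Delta g)-\Gamma(\Delta f,g)$, $\Gamma(f)=\Gamma(f,f)$, $\Gamma_2(f)=\Gamma_2(f,f)$. The graph satisfies $CD(0,\infty)$ if $\Gamma_2(f)(x)\ge0$ for all $f:V\to\mathbb R$ and all $x\in V$. Cartesian product: for graphs $(V_1,E_1)$, $(V_2,E_2)$ it has vertex set $V_1\times V_2$, and $(u_1,v_1),(u_2,v_2)$ are adjacent iff either $u_1=u_2$ and $\{v_1,v_2\}\in E_2$, or $\{u_1,u_2\}\in E_1$ and $v_1=v_2$. A Cayley graph $\mathrm{Cay}(\Gamma,S)$ of a group $\Gamma$ with a finite symmetric generating set $S\subset\Gamma$ not containing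 the identity has vertex set $\Gamma$, with $g$ adjacent to $gs$ for all $g\in\Gamma$, $s\in S$; "is a Cayley graph" means isomorphic to such a graph. *)

theory Defs
  imports Complex_Main "HOL-Algebra.Generated_Groups"
begin

section \<open>Simple graphs\<close>

record 'v ugraph =
  vertices :: "'v set"
  edges :: "'v set set"

definition simple_graph :: "'v ugraph \<Rightarrow> bool" where
  "simple_graph X \<longleftrightarrow> (\<forall>e\<in>edges X. e \<subseteq> vertices X \<and> card e = 2)"

definition neighbors :: "'v ugraph \<Rightarrow> 'v \<Rightarrow> 'v set" where
  "neighbors X x = {y. {x, y} \<in> edges X}"

definition locally_finite :: "'v ugraph \<Rightarrow> bool" where
  "locally_finite X \<longleftrightarrow> (\<forall>x\<in>vertices X. finite (neighbors X x))"

definition regular_graph :: "nat \<Rightarrow> 'v ugraph \<Rightarrow> bool" where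
  "regular_graph k X \<longleftrightarrow>
     (\<forall>x\<in>vertices X. finite (neighbors X x) \<and> card (neighbors X x) = k)"

definition graph_isomorphic :: "'v ugraph \<Rightarrow> 'w ugraph \<Rightarrow> bool" where
  "graph_isomorphic X Y \<longleftrightarrow>
     (\<exists>\<phi>. bij_betw \<phi> (vertices X) (vertices Y) \<and>
          (\<forall>x\<in>vertices X. \<forall>y\<in>vertices X. {x, y} \<in> edges X \<longleftrightarrow> {\<phi> x, \<phi> y} \<in> edges Y))"

definition cartesian_product :: "'v ugraph \<Rightarrow> 'w ugraph \<Rightarrow> ('v \<times> 'w) ugraph" where
  "cartesian_product X Y =
     \<lparr>vertices = vertices X \<times> vertices Y,
      edges = {{(u\<^sub>1, v\<^sub>1), (u\<^sub>2, v\<^sub>2)} | u\<^sub>1 v\<^sub>1 u\<^sub>2 v\<^sub>2.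
                 u\<^sub>1 \<in> vertices X \<and> u\<^sub>2 \<in> vertices X \<and> v\<^sub>1 \<in> vertices Y \<and> v\<^sub>2 \<in> vertices Y \<and>
                 (u\<^sub>1 = u\<^sub>2 \<and> {v\<^sub>1, v\<^sub>2} \<in> edges Y \<or> {u\<^sub>1, u\<^sub>2} \<in> edges X \<and> v\<^sub>1 = v\<^sub>2)}\<rparr>"


section \<open>Bakry--Emery curvature\<close>

text \<open>
  A function on the vertex set is represented by a total function. In a simple graph,
  the operators below, evaluated at a vertex, only involve values at vertices, so the
  values outside the vertex set are irrelevant.
\<close>

definition laplacian :: "'v ugraph \<Rightarrow> ('v \<Rightarrow> real) \<Rightarrow> 'v \<Rightarrow> real" where
  "laplacian X f x = (\<Sum>y\<in>neighbors X x. f y - f x)"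

definition Gamma :: "'v ugraph \<Rightarrow> ('v \<Rightarrow> real) \<Rightarrow> ('v \<Rightarrow> real) \<Rightarrow> 'v \<Rightarrow> real" where
  "Gamma X f g x =
     (laplacian X (\<lambda>y. f y * g y) x - f x * laplacian X g x - g x * laplacian X f x) / 2"

definition Gamma2 :: "'v ugraph \<Rightarrow> ('v \<Rightarrow> real) \<Rightarrow> ('v \<Rightarrow> real) \<Rightarrow> 'v \<Rightarrow> real" where
  "Gamma2 X f g x =
     (laplacian X (Gamma X f g) x - Gamma X f (laplacian X g) x
        - Gamma X (laplacian X f) g x) / 2"

definition CD_0_infinity :: "'v ugraph \<Rightarrow> bool" where
  "CD_0_infinity X \<longleftrightarrow>
     simple_graph X \<and> locally_finite X \<and>
     (\<forall>f :: 'v \<Rightarrow> real. \<forall>x\<in>vertices X. Gamma2 X f f x \<ge> 0)"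


section \<open>Cayley graphs\<close>

definition cayley_generating_set :: "('g, 'b) monoid_scheme \<Rightarrow> 'g set \<Rightarrow> bool" where
  "cayley_generating_set H S \<longleftrightarrow>
     S \<subseteq> carrier H \<and> finite S \<and> (\<forall>s\<in>S. inv\<^bsub>H\<^esub> s \<in> S) \<and> \<one>\<^bsub>H\<^esub> \<notin> S \<and>
     generate H S = carrier H"

definition cayley_graph :: "('g, 'b) monoid_scheme \<Rightarrow> 'g set \<Rightarrow> 'g ugraph" where
  "cayley_graph H S =
     \<lparr>vertices = carrier H,
      edges = {{g, g \<otimes>\<^bsub>H\<^esub> s} | g s. g \<in> carrier H \<and> s \<in> S}\<rparr>"

text \<open>
  HOL cannot quantify over types inside a formula, so the type of the group elements is a
  parameter; a theorem with a free type variable in this position covers all groups.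
\<close>

definition is_cayley_graph :: "'g itself \<Rightarrow> 'v ugraph \<Rightarrow> bool" where
  "is_cayley_graph T X \<longleftrightarrow>
     (\<exists>(H :: 'g monoid) S. group H \<and> cayley_generating_set H S \<and>
        graph_isomorphic X (cayley_graph H S))"


section \<open>The example\<close>

datatype base_vertex = X nat | Y nat

definition base_graph :: "base_vertex ugraph" where
  "base_graph =
     \<lparr>vertices = X ` {1..3} \<union> Y ` {1..4},
      edges = {{X i, Y j} | i j. i \<in> {1..3} \<and> j \<in> {1..4}} \<union> {{Y 1, Y 2}, {Y 3, Y 4}}\<rparr>"

definition cycle_graph :: "nat \<Rightarrow> nat ugraph" where
  "cycle_graph n =
     \<lparr>vertices = {..<n}, edges = {{i, (i + 1) mod n} | i. i < n}\<rparr>"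

definition example_graph :: "nat \<Rightarrow> (base_vertex \<times> nat) ugraph" where
  "example_graph n = cartesian_product base_graph (cycle_graph n)"

end

(* The mixed terms in Gamma_2 of a Cartesian product add up to a sum of squares, so CD(0,oo) passes to
   products; it is then enough to diagonalise Gamma_2 at the vertices of the base graph and of the
   cycle. A Cayley graph is vertex-transitive, so all its vertices lie on equally many triangles. In a
   product this number is additive, and it differs between X 1 and Y 1 in the base graph. *)
theory Submission
  imports Defs
begin

section \<open>Neighbourhoods and Cartesian products\<close>

lemma neighbors_commute: "y \<in> neighbors G x \<longleftrightarrow> x \<in> neighbors G y"
  by (simp add: neighbors_def insert_commute)

lemma simple_graph_neighbors:
  assumes "simple_graph G" "y \<in> neighbors G x"
  shows "x \<in> vertices G" "y \<in> vertices G" "x \<noteq> y"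
proof -
  have "{x, y} \<subseteq> vertices G" "card {x, y} = 2"
    using assms by (auto simp: simple_graph_def neighbors_def)
  then show "x \<in> vertices G" "y \<in> vertices G" "x \<noteq> y" by auto
qed

lemma mem_neighbors_cartesian_product:
  "(u', v') \<in> neighbors (cartesian_product G H) (u, v) \<longleftrightarrow>
    u \<in> vertices G \<and> u' \<in> vertices G \<and> v \<in> vertices H \<and> v' \<in> vertices H \<and>
    (u = u' \<and> v' \<in> neighbors H v \<or> u' \<in> neighbors G u \<and> v = v')" (is "?L \<longleftrightarrow> ?R")
proof
  assume ?L
  then obtain u\<^sub>1 v\<^sub>1 u\<^sub>2 v\<^sub>2 where *: "{(u, v), (u', v')} = {(u\<^sub>1, v\<^sub>1), (u\<^sub>2, v\<^sub>2)}"
    "u\<^sub>1 \<in> vertices G" "u\<^sub>2 \<in> vertices G" "v\<^sub>1 \<in> vertices H" "v\<^sub>2 \<in> vertices H"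
    "u\<^sub>1 = u\<^sub>2 \<and> {v\<^sub>1, v\<^sub>2} \<in> edges H \<or> {u\<^sub>1, u\<^sub>2} \<in> edges G \<and> v\<^sub>1 = v\<^sub>2"
    unfolding neighbors_def cartesian_product_def by auto
  \<comment> \<open>An edge is an unordered pair, so the representation found may list its endpoints
    in either order.\<close>
  from *(1) consider "u = u\<^sub>1" "v = v\<^sub>1" "u' = u\<^sub>2" "v' = v\<^sub>2" | "u = u\<^sub>2" "v = v\<^sub>2" "u' = u\<^sub>1" "v' = v\<^sub>1"
    unfolding doubleton_eq_iff by blast
  then show ?R
    by cases (use *(2-) in \<open>auto simp: neighbors_def insert_commute\<close>)
next
  assume ?R
  then show ?L unfolding neighbors_def cartesian_product_def by auto
qed

lemma neighbors_cartesian_product: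
  assumes "simple_graph G" "simple_graph H" "u \<in> vertices G" "v \<in> vertices H"
  shows "neighbors (cartesian_product G H) (u, v)
    = (\<lambda>u'. (u', v)) ` neighbors G u \<union> Pair u ` neighbors H v"
  using assms(3,4) simple_graph_neighbors[OF assms(1)] simple_graph_neighbors[OF assms(2)]
  by (auto simp: mem_neighbors_cartesian_product)

lemma sum_neighbors_cartesian_product:
  fixes F :: "'v \<times> 'w \<Rightarrow> 'a::comm_monoid_add"
  assumes "simple_graph G" "simple_graph H" "locally_finite G" "locally_finite H"
    "u \<in> vertices G" "v \<in> vertices H"
  shows "sum F (neighbors (cartesian_product G H) (u, v))
    = (\<Sum>u'\<in>neighbors G u. F (u', v)) + (\<Sum>v'\<in>neighbors H v. F (u, v'))"
proof -
  have "finite (neighbors G u)" "finite (neighbors H v)"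
    using assms by (auto simp: locally_finite_def)
  \<comment> \<open>A common element could only be \<open>(u, v)\<close> itself, and then
    \<open>u\<close> would be its own neighbour.\<close>
  moreover have "(\<lambda>u'. (u', v)) ` neighbors G u \<inter> Pair u ` neighbors H v = {}"
    using simple_graph_neighbors[OF assms(1)] by fastforce
  ultimately show ?thesis
    by (simp add: neighbors_cartesian_product assms sum.union_disjoint sum.reindex inj_on_def)
qed

lemma vertices_cartesian_product [simp]:
  "vertices (cartesian_product G H) = vertices G \<times> vertices H"
  by (simp add: cartesian_product_def)

lemma simple_graph_cartesian_product:
  assumes "simple_graph G" "simple_graph H"
  shows "simple_graph (cartesian_product G H)"
proof -
  have "e \<subseteq> vertices G \<times> vertices H \<and> card e = 2" if e: "e \<in> edges (cartesian_product G H)" for e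
  proof -
    obtain u\<^sub>1 v\<^sub>1 u\<^sub>2 v\<^sub>2 where *: "e = {(u\<^sub>1, v\<^sub>1), (u\<^sub>2, v\<^sub>2)}"
      "u\<^sub>1 \<in> vertices G" "u\<^sub>2 \<in> vertices G" "v\<^sub>1 \<in> vertices H" "v\<^sub>2 \<in> vertices H"
      "u\<^sub>1 = u\<^sub>2 \<and> v\<^sub>2 \<in> neighbors H v\<^sub>1 \<or> u\<^sub>2 \<in> neighbors G u\<^sub>1 \<and> v\<^sub>1 = v\<^sub>2"
      using e by (auto simp: cartesian_product_def neighbors_def)
    \<comment> \<open>Coinciding endpoints would force a loop in one of the factors.\<close>
    then have "(u\<^sub>1, v\<^sub>1) \<noteq> (u\<^sub>2, v\<^sub>2)"
      using simple_graph_neighbors(3)[OF assms(1)] simple_graph_neighbors(3)[OF assms(2)] by blast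
    with * show ?thesis by auto
  qed
  then show ?thesis by (simp add: simple_graph_def)
qed

lemma regular_imp_locally_finite: "regular_graph k G \<Longrightarrow> locally_finite G"
  by (simp add: regular_graph_def locally_finite_def)

lemma regular_graph_cartesian_product:
  assumes "simple_graph G" "simple_graph H" "regular_graph k G" "regular_graph l H"
  shows "regular_graph (k + l) (cartesian_product G H)"
proof -
  \<comment> \<open>The degree is the neighbourhood sum of the constant 1, so it splits like any
    other such sum.\<close>
  have "finite (neighbors (cartesian_product G H) (u, v))
      \<and> card (neighbors (cartesian_product G H) (u, v)) = k + l"
    if "u \<in> vertices G" "v \<in> vertices H" for u v
    using that assms(3,4) neighbors_cartesian_product[OF assms(1,2) that]
      sum_neighbors_cartesian_product[OF assms(1,2) regular_imp_locally_finite[OF assms(3)]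
        regular_imp_locally_finite[OF assms(4)] that, of "\<lambda>_. 1::nat"]
    by (simp add: regular_graph_def)
  then show ?thesis by (auto simp: regular_graph_def)
qed

section \<open>Curvature of Cartesian products\<close>

lemma Gamma_eq_sum:
  "Gamma G f g x = (\<Sum>y\<in>neighbors G x. (f y - f x) * (g y - g x)) / 2"
  unfolding Gamma_def laplacian_def sum_distrib_left sum_subtractf[symmetric]
  by (simp add: algebra_simps)

text \<open>By symmetry of Gamma the two subtracted terms agree. Writing everything as one sum over
  the neighbours of \<open>x\<close> lets it split along the directions of a product.\<close>

lemma Gamma2_eq_sum:
  "Gamma2 G f f x = (\<Sum>y\<in>neighbors G x. Gamma G f f y - Gamma G f f x
      - (f y - f x) * (laplacian G f y - laplacian G f x)) / 2"
proof -
  have "Gamma G (laplacian G f) f x = Gamma G f (laplacian G f) x"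
    by (simp add: Gamma_eq_sum mult.commute)
  then show ?thesis
    by (simp add: Gamma2_def Gamma_eq_sum[of G f "laplacian G f"] laplacian_def[of G "Gamma G f f"]
        sum_subtractf)
qed

text \<open>Laplacian and Gamma are additive over the two directions. Moving along an edge of one
  factor and following the operators of the same factor gives that factor's own Gamma2; following
  the operators of the other factor gives the mixed terms, which combine to squares of mixed second
  differences.\<close>

lemma Gamma2_cartesian_product:
  assumes "simple_graph G" "simple_graph H" "locally_finite G" "locally_finite H"
    and uv: "u \<in> vertices G" "v \<in> vertices H"
  shows "Gamma2 (cartesian_product G H) f f (u, v)
    = Gamma2 G (\<lambda>u'. f (u', v)) (\<lambda>u'. f (u', v)) u + Gamma2 H (\<lambda>v'. f (u, v')) (\<lambda>v'. f (u, v')) v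
      + (\<Sum>u'\<in>neighbors G u. \<Sum>v'\<in>neighbors H v.
          (f (u', v') - f (u', v) - f (u, v') + f (u, v))\<^sup>2) / 2"
proof -
  let ?P = "cartesian_product G H"
  let ?f1 = "\<lambda>v u. f (u, v)" and ?f2 = "\<lambda>u v. f (u, v)"
  note sum_P = sum_neighbors_cartesian_product[OF assms(1-4)]
  have lap: "laplacian ?P f (a, b) = laplacian G (?f1 b) a + laplacian H (?f2 a) b"
    and gam: "Gamma ?P f f (a, b) = Gamma G (?f1 b) (?f1 b) a + Gamma H (?f2 a) (?f2 a) b"
    if "a \<in> vertices G" "b \<in> vertices H" for a b
    using that by (simp_all add: laplacian_def Gamma_eq_sum sum_P add_divide_distrib)
  define Q1 where "Q1 b a = Gamma G (?f1 b) (?f1 b) a" for b a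
  define Q2 where "Q2 a b = Gamma H (?f2 a) (?f2 a) b" for a b
  define L1 where "L1 b a = laplacian G (?f1 b) a" for b a
  define L2 where "L2 a b = laplacian H (?f2 a) b" for a b
  \<comment> \<open>The mixed terms: \<open>?A\<close> follows the operators of \<open>H\<close>
    along an edge of \<open>G\<close>, and \<open>?B\<close> those of \<open>G\<close> along an edge
    of \<open>H\<close>.\<close>
  let ?A = "\<lambda>u'. Q2 u' v - Q2 u v - (f (u', v) - f (u, v)) * (L2 u' v - L2 u v)"
  let ?B = "\<lambda>v'. Q1 v' u - Q1 v u - (f (u, v') - f (u, v)) * (L1 v' u - L1 v u)"
  \<comment> \<open>The increments of \<open>f\<close> along the four sides of the square spanned by
    the edges \<open>u u'\<close> and \<open>v v'\<close>. Going round it,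
    \<open>?a - ?b = ?d - ?c\<close>; call this \<open>w\<close>.\<close>
  let ?a = "\<lambda>u' v'. f (u', v') - f (u', v)" and ?b = "\<lambda>v'. f (u, v') - f (u, v)"
  let ?c = "\<lambda>u'. f (u', v) - f (u, v)" and ?d = "\<lambda>u' v'. f (u', v') - f (u, v')"
  have "?A u' = (\<Sum>v'\<in>neighbors H v. ((?a u' v')\<^sup>2 - (?b v')\<^sup>2) / 2 - ?c u' * (?a u' v' - ?b v'))" for u'
    by (simp add: Q2_def L2_def Gamma_eq_sum laplacian_def sum_subtractf sum_distrib_left
        power2_eq_square diff_divide_distrib sum_divide_distrib right_diff_distrib)
  then have A: "sum ?A (neighbors G u) = (\<Sum>u'\<in>neighbors G u. \<Sum>v'\<in>neighbors H v.
      ((?a u' v')\<^sup>2 - (?b v')\<^sup>2) / 2 - ?c u' * (?a u' v' - ?b v'))"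
    by simp
  have "?B v' = (\<Sum>u'\<in>neighbors G u. ((?d u' v')\<^sup>2 - (?c u')\<^sup>2) / 2 - ?b v' * (?d u' v' - ?c u'))" for v'
    by (simp add: Q1_def L1_def Gamma_eq_sum laplacian_def sum_subtractf sum_distrib_left
        power2_eq_square diff_divide_distrib sum_divide_distrib right_diff_distrib)
  then have B: "sum ?B (neighbors H v) = (\<Sum>u'\<in>neighbors G u. \<Sum>v'\<in>neighbors H v.
      ((?d u' v')\<^sup>2 - (?c u')\<^sup>2) / 2 - ?b v' * (?d u' v' - ?c u'))"
    by (simp add: sum.swap[of _ "neighbors G u"])
  \<comment> \<open>For each square the summands are \<open>w * ((?a + ?b) / 2 - ?c)\<close> and
    \<open>w * ((?d + ?c) / 2 - ?b)\<close>; they add up to the square of \<open>w\<close>.\<close>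
  have mixed: "sum ?A (neighbors G u) + sum ?B (neighbors H v) =
      (\<Sum>u'\<in>neighbors G u. \<Sum>v'\<in>neighbors H v. (f (u', v') - f (u', v) - f (u, v') + f (u, v))\<^sup>2)"
    unfolding A B sum.distrib[symmetric]
    by (intro sum.cong refl) (simp add: power2_eq_square field_simps)
  have 1: "(\<Sum>u'\<in>neighbors G u. Gamma ?P f f (u', v) - Gamma ?P f f (u, v)
        - (f (u', v) - f (u, v)) * (laplacian ?P f (u', v) - laplacian ?P f (u, v)))
      = 2 * Gamma2 G (?f1 v) (?f1 v) u + sum ?A (neighbors G u)"
    unfolding Gamma2_eq_sum using uv
    by (simp add: sum.distrib[symmetric] Q2_def L2_def,
        intro sum.cong refl)
      (simp add: gam lap simple_graph_neighbors(2)[OF assms(1)] algebra_simps)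
  have 2: "(\<Sum>v'\<in>neighbors H v. Gamma ?P f f (u, v') - Gamma ?P f f (u, v)
        - (f (u, v') - f (u, v)) * (laplacian ?P f (u, v') - laplacian ?P f (u, v)))
      = 2 * Gamma2 H (?f2 u) (?f2 u) v + sum ?B (neighbors H v)"
    unfolding Gamma2_eq_sum using uv
    by (simp add: sum.distrib[symmetric] Q1_def L1_def,
        intro sum.cong refl)
      (simp add: gam lap simple_graph_neighbors(2)[OF assms(2)] algebra_simps)
  show ?thesis
    unfolding mixed[symmetric] Gamma2_eq_sum[of ?P] sum_P[OF uv] 1 2 by simp
qed

lemma CD_0_infinity_cartesian_product:
  assumes "CD_0_infinity G" "CD_0_infinity H"
  shows "CD_0_infinity (cartesian_product G H)"
proof -
  have *: "simple_graph G" "simple_graph H" "locally_finite G" "locally_finite H"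
    using assms by (auto simp: CD_0_infinity_def)
  have "Gamma2 (cartesian_product G H) f f (u, v) \<ge> 0"
    if "u \<in> vertices G" "v \<in> vertices H" for f u v
    using that assms unfolding Gamma2_cartesian_product[OF * that]
    by (intro add_nonneg_nonneg divide_nonneg_pos sum_nonneg) (auto simp: CD_0_infinity_def)
  moreover have "locally_finite (cartesian_product G H)"
    using * by (auto simp: locally_finite_def neighbors_cartesian_product)
  ultimately show ?thesis
    using * by (auto simp: CD_0_infinity_def simple_graph_cartesian_product)
qed

section \<open>Triangles and vertex-transitivity\<close>

text \<open>Every triangle through the vertex is counted once for each of its two orientations.\<close>

definition triangles_at :: "'v ugraph \<Rightarrow> 'v \<Rightarrow> ('v \<times> 'v) set" where
  "triangles_at G x = {(y, z). y \<in> neighbors G x \<and> z \<in> neighbors G x \<and> z \<in> neighbors G y}"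

lemma finite_triangles_at:
  assumes "locally_finite G" "x \<in> vertices G"
  shows "finite (triangles_at G x)"
  by (rule finite_subset[of _ "neighbors G x \<times> neighbors G x"])
    (use assms in \<open>auto simp: triangles_at_def locally_finite_def\<close>)

text \<open>A step in \<open>G\<close> and a step in \<open>H\<close> from the same vertex end at
  points that differ in both coordinates, hence are not adjacent. So each triangle stays inside one
  copy of a factor.\<close>

lemma card_triangles_at_cartesian_product:
  assumes "simple_graph G" "simple_graph H" "locally_finite G" "locally_finite H"
    "u \<in> vertices G" "v \<in> vertices H"
  shows "card (triangles_at (cartesian_product G H) (u, v))
    = card (triangles_at G u) + card (triangles_at H v)"
proof -
  let ?i = "map_prod (\<lambda>a. (a, v)) (\<lambda>a. (a, v))" and ?j = "map_prod (Pair u) (Pair u)"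
  note G = simple_graph_neighbors[OF assms(1)] and H = simple_graph_neighbors[OF assms(2)]
  note N = neighbors_cartesian_product[OF assms(1,2)]
  have "triangles_at (cartesian_product G H) (u, v) = ?i ` triangles_at G u \<union> ?j ` triangles_at H v"
    (is "?T = ?R")
  proof (intro equalityI subsetI)
    fix p assume p: "p \<in> ?T"
    obtain a b c d where abcd: "p = ((a, b), (c, d))" by (metis surj_pair)
    with p have *: "(a, b) \<in> neighbors (cartesian_product G H) (u, v)"
      "(c, d) \<in> neighbors (cartesian_product G H) (u, v)"
      "(c, d) \<in> neighbors (cartesian_product G H) (a, b)"
      by (auto simp: triangles_at_def)
    \<comment> \<open>The neighbourhood formula is also to be applied at \<open>(a, b)\<close>,
      which must first be known to be a vertex.\<close>
    from *(1) have "a \<in> vertices G" "b \<in> vertices H"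
      using assms(5,6) G(2) H(2) by (auto simp: N)
    with * have "b = v \<and> d = v \<and> (a, c) \<in> triangles_at G u \<or> a = u \<and> c = u \<and> (b, d) \<in> triangles_at H v"
      using assms(5,6) G(3) H(3) by (auto simp: N triangles_at_def)
    then show "p \<in> ?R" by (force simp: abcd)
  next
    fix p assume "p \<in> ?R"
    then show "p \<in> ?T"
      using assms(5,6) G(2) H(2) by (auto simp: N triangles_at_def)
  qed
  \<comment> \<open>A pair in both images would have first entry \<open>(u, v)\<close>, making
    \<open>u\<close> adjacent to itself.\<close>
  moreover have "?i ` triangles_at G u \<inter> ?j ` triangles_at H v = {}"
    using G(3) H(3) by (fastforce simp: triangles_at_def)
  moreover have "inj_on ?i (triangles_at G u)" "inj_on ?j (triangles_at H v)"
    by (auto simp: inj_on_def)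
  ultimately show ?thesis
    using assms by (simp add: card_Un_disjoint finite_triangles_at card_image)
qed

section \<open>Automorphisms, left translations and vertex-transitivity of Cayley graphs\<close>

definition graph_automorphism :: "'v ugraph \<Rightarrow> ('v \<Rightarrow> 'v) \<Rightarrow> bool" where
  "graph_automorphism G \<pi> \<longleftrightarrow> bij_betw \<pi> (vertices G) (vertices G) \<and>
    (\<forall>x\<in>vertices G. \<forall>y\<in>vertices G. {x, y} \<in> edges G \<longleftrightarrow> {\<pi> x, \<pi> y} \<in> edges G)"

lemma card_triangles_at_automorphism:
  assumes "simple_graph G" "graph_automorphism G \<pi>" "x \<in> vertices G"
  shows "card (triangles_at G (\<pi> x)) = card (triangles_at G x)"
proof -
  have adj: "\<pi> b \<in> neighbors G (\<pi> a) \<longleftrightarrow> b \<in> neighbors G a" if "a \<in> vertices G" "b \<in> vertices G" for a b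
    using assms(2) that by (auto simp: graph_automorphism_def neighbors_def)
  have bij: "bij_betw \<pi> (vertices G) (vertices G)"
    using assms(2) by (simp add: graph_automorphism_def)
  note G = simple_graph_neighbors(2)[OF assms(1)]
  have "triangles_at G (\<pi> x) = map_prod \<pi> \<pi> ` triangles_at G x"
  proof (intro equalityI subsetI)
    fix p assume p: "p \<in> triangles_at G (\<pi> x)"
    then have "p \<in> vertices G \<times> vertices G" by (auto simp: triangles_at_def intro: G)
    then have "p \<in> \<pi> ` vertices G \<times> \<pi> ` vertices G"
      by (simp only: bij_betw_imp_surj_on[OF bij])
    then obtain y z where yz: "y \<in> vertices G" "z \<in> vertices G" "p = (\<pi> y, \<pi> z)"
      by blast
    with p have "(y, z) \<in> triangles_at G x"
      using assms(3) by (simp add: triangles_at_def adj)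
    then show "p \<in> map_prod \<pi> \<pi> ` triangles_at G x" using yz(3) by force
  next
    fix p assume "p \<in> map_prod \<pi> \<pi> ` triangles_at G x"
    then show "p \<in> triangles_at G (\<pi> x)"
      using assms(3) by (auto simp: triangles_at_def adj G)
  qed
  moreover have "inj_on (map_prod \<pi> \<pi>) (triangles_at G x)"
    by (rule inj_on_subset[OF map_prod_inj_on[OF bij_betw_imp_inj_on[OF bij] bij_betw_imp_inj_on[OF bij]]])
      (auto simp: triangles_at_def intro: G)
  ultimately show ?thesis by (simp add: card_image)
qed

text \<open>Edges come from right multiplication by elements of \<open>S\<close>, and left
  multiplication commutes with it by associativity.\<close>

lemma cayley_graph_left_translation:
  assumes "group H" "S \<subseteq> carrier H" "h \<in> carrier H"
  shows "graph_automorphism (cayley_graph H S) (\<lambda>g. h \<otimes>\<^bsub>H\<^esub> g)"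
proof -
  interpret group H by fact
  have "{g\<^sub>1, g\<^sub>2} \<in> edges (cayley_graph H S) \<longleftrightarrow> (\<exists>s\<in>S. g\<^sub>2 = g\<^sub>1 \<otimes>\<^bsub>H\<^esub> s \<or> g\<^sub>1 = g\<^sub>2 \<otimes>\<^bsub>H\<^esub> s)"
    if "g\<^sub>1 \<in> carrier H" "g\<^sub>2 \<in> carrier H" for g\<^sub>1 g\<^sub>2
    using that by (auto simp: cayley_graph_def doubleton_eq_iff)
  moreover have "h \<otimes>\<^bsub>H\<^esub> a = h \<otimes>\<^bsub>H\<^esub> b \<otimes>\<^bsub>H\<^esub> s \<longleftrightarrow> a = b \<otimes>\<^bsub>H\<^esub> s"
    if "a \<in> carrier H" "b \<in> carrier H" "s \<in> S" for a b s
    using that assms(2,3) by (auto simp: m_assoc)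
  moreover have "bij_betw (\<lambda>g. h \<otimes>\<^bsub>H\<^esub> g) (carrier H) (carrier H)"
    using assms(3) by (simp add: bij_betw_def inj_on_cmult surj_const_mult)
  ultimately show ?thesis
    using assms(3) by (auto simp: graph_automorphism_def cayley_graph_def)
qed

lemma is_cayley_graph_vertex_transitive:
  assumes "is_cayley_graph TYPE('g) G" "x \<in> vertices G" "y \<in> vertices G"
  obtains \<pi> where "graph_automorphism G \<pi>" "\<pi> x = y"
proof -
  obtain H :: "'g monoid" and S \<phi> where H: "group H" "S \<subseteq> carrier H"
    and \<phi>: "bij_betw \<phi> (vertices G) (carrier H)"
    and edge: "\<And>a b. a \<in> vertices G \<Longrightarrow> b \<in> vertices G \<Longrightarrow>
      {a, b} \<in> edges G \<longleftrightarrow> {\<phi> a, \<phi> b} \<in> edges (cayley_graph H S)"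
    using assms(1)
    by (auto simp: is_cayley_graph_def graph_isomorphic_def cayley_generating_set_def cayley_graph_def)
  interpret group H by fact
  \<comment> \<open>Left translation by this \<open>h\<close> takes \<open>\<phi> x\<close> to
    \<open>\<phi> y\<close>; conjugating it with \<open>\<phi>\<close> gives the automorphism of
    \<open>G\<close>.\<close>
  define h where "h = \<phi> y \<otimes>\<^bsub>H\<^esub> inv\<^bsub>H\<^esub> \<phi> x"
  define \<tau> where "\<tau> = (\<lambda>g. h \<otimes>\<^bsub>H\<^esub> g)"
  define \<psi> where "\<psi> = inv_into (vertices G) \<phi>"
  have \<phi>_in: "\<phi> a \<in> carrier H" if "a \<in> vertices G" for a
    using that \<phi> by (auto simp: bij_betw_def)
  have h: "h \<in> carrier H" using assms \<phi>_in by (simp add: h_def)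
  have \<psi>: "bij_betw \<psi> (carrier H) (vertices G)"
    unfolding \<psi>_def by (rule bij_betw_inv_into[OF \<phi>])
  have \<phi>\<psi>: "\<phi> (\<psi> g) = g" if "g \<in> carrier H" for g
    using that \<phi> by (simp add: \<psi>_def bij_betw_inv_into_right)
  have \<psi>_in: "\<psi> g \<in> vertices G" if "g \<in> carrier H" for g
    using that \<psi> by (auto simp: bij_betw_def)
  have \<tau>: "bij_betw \<tau> (carrier H) (carrier H)"
    "\<And>a b. a \<in> carrier H \<Longrightarrow> b \<in> carrier H \<Longrightarrow>
      {a, b} \<in> edges (cayley_graph H S) \<longleftrightarrow> {\<tau> a, \<tau> b} \<in> edges (cayley_graph H S)"
    using cayley_graph_left_translation[OF H h]
    by (auto simp: graph_automorphism_def \<tau>_def cayley_graph_def)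
  have \<tau>_in: "\<tau> g \<in> carrier H" if "g \<in> carrier H" for g
    using that h by (simp add: \<tau>_def)
  have "bij_betw (\<psi> \<circ> \<tau> \<circ> \<phi>) (vertices G) (vertices G)"
    by (intro bij_betw_trans[OF \<phi>] bij_betw_trans[OF \<tau>(1)] \<psi>)
  then have "graph_automorphism G (\<psi> \<circ> \<tau> \<circ> \<phi>)"
    by (simp add: graph_automorphism_def edge \<psi>_in \<tau>_in \<phi>_in \<phi>\<psi> \<tau>(2)[symmetric])
  moreover have "(\<psi> \<circ> \<tau> \<circ> \<phi>) x = y"
    using assms(2,3) \<phi> \<phi>_in by (simp add: \<tau>_def h_def m_assoc \<psi>_def bij_betw_inv_into_left)
  ultimately show thesis by (rule that)
qed

lemma is_cayley_graph_card_triangles_at: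
  assumes "is_cayley_graph TYPE('g) G" "simple_graph G" "x \<in> vertices G" "y \<in> vertices G"
  shows "card (triangles_at G x) = card (triangles_at G y)"
  using is_cayley_graph_vertex_transitive[OF assms(1,3,4)]
    card_triangles_at_automorphism[OF assms(2) _ assms(3)] by metis

section \<open>The cycle\<close>

text \<open>Describes the predecessor on the cycle. Adding \<open>n\<close> before subtracting 1
  avoids truncated subtraction at \<open>i = 0\<close>.\<close>

lemma cycle_graph_pred_iff:
  fixes i j n :: nat
  assumes "i < n"
  shows "i = (j + 1) mod n \<and> j < n \<longleftrightarrow> j = (i + n - 1) mod n"
  using assms by (cases "j + 1 = n"; cases "i = 0") (auto simp: mod_if)

lemma neighbors_cycle_graph:
  assumes "i < n"
  shows "neighbors (cycle_graph n) i = {(i + 1) mod n, (i + n - 1) mod n}"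
proof -
  have "j \<in> neighbors (cycle_graph n) i \<longleftrightarrow> j = (i + 1) mod n \<or> (i = (j + 1) mod n \<and> j < n)" for j
    unfolding neighbors_def cycle_graph_def using assms
    by (simp only: ugraph.simps mem_Collect_eq doubleton_eq_iff) metis
  then show ?thesis unfolding cycle_graph_pred_iff[OF assms] by auto
qed

lemma simple_cycle_graph:
  assumes "n \<ge> 3"
  shows "simple_graph (cycle_graph n)"
proof -
  have "i \<noteq> (i + 1) mod n" if "i < n" for i
    using that assms by (cases "i + 1 = n") auto
  then show ?thesis
    using assms by (fastforce simp: simple_graph_def cycle_graph_def)
qed

text \<open>The bound \<open>n \<ge> 3\<close> matters here: for \<open>n = 2\<close> successor and
  predecessor coincide and the degree drops to 1.\<close>

lemma cycle_graph_succ_neq_pred: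
  fixes i n :: nat
  assumes "n \<ge> 3" "i < n"
  shows "(i + 1) mod n \<noteq> (i + n - 1) mod n"
  using assms by (cases "i + 1 = n"; cases "i = 0") (auto simp: mod_if)

lemma regular_cycle_graph:
  assumes "n \<ge> 3"
  shows "regular_graph 2 (cycle_graph n)"
proof -
  have "finite (neighbors (cycle_graph n) i) \<and> card (neighbors (cycle_graph n) i) = 2" if "i < n" for i
    using cycle_graph_succ_neq_pred[OF assms that] by (simp add: neighbors_cycle_graph[OF that])
  then show ?thesis by (simp add: regular_graph_def cycle_graph_def)
qed

lemma CD_cycle_graph:
  assumes "n \<ge> 3"
  shows "CD_0_infinity (cycle_graph n)"
proof -
  define p where "p i = (i + 1) mod n" for i
  define m where "m i = (i + n - 1) mod n" for i
  have "Gamma2 (cycle_graph n) f f i \<ge> 0" if i: "i < n" for f i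
  proof -
    have lt: "p j < n" "m j < n" for j using assms by (simp_all add: p_def m_def)
    have pm: "p (m j) = j" "m (p j) = j" if "j < n" for j
      using cycle_graph_pred_iff[OF that] cycle_graph_pred_iff[OF lt(1)] that
      unfolding p_def m_def by metis+
    have s: "sum F (neighbors (cycle_graph n) j) = F (p j) + F (m j)" if "j < n" for F :: "nat \<Rightarrow> real" and j
      using that cycle_graph_succ_neq_pred[OF assms that]
      by (simp add: neighbors_cycle_graph p_def m_def)
    \<comment> \<open>The squares are those of the Laplacian of \<open>f\<close> at
      \<open>p i\<close>, at \<open>m i\<close> and, with weight 2, at \<open>i\<close>. This is a
      polynomial identity in the five values of \<open>f\<close>, so it survives coincidences of
      vertices such as \<open>p (p i) = m i\<close> for \<open>n = 3\<close>.\<close>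
    have eq: "Gamma2 (cycle_graph n) f f i = ((f (p (p i)) - 2 * f (p i) + f i)\<^sup>2 + (f (m (m i)) - 2 * f (m i) + f i)\<^sup>2
      + 2 * (f (p i) - 2 * f i + f (m i))\<^sup>2) / 4"
      unfolding Gamma2_eq_sum using i
      by (simp add: Gamma_eq_sum laplacian_def s lt pm power2_eq_square) (simp add: field_simps)
    show ?thesis unfolding eq by simp
  qed
  then show ?thesis
    using assms simple_cycle_graph regular_imp_locally_finite[OF regular_cycle_graph]
    by (simp add: CD_0_infinity_def cycle_graph_def)
qed

section \<open>The base graph\<close>

lemma atLeastAtMost_3_4: "{1..3::nat} = {1, 2, 3}" "{1..4::nat} = {1, 2, 3, 4}"
  by auto

lemma vertices_base_graph: "vertices base_graph = {X 1, X 2, X 3, Y 1, Y 2, Y 3, Y 4}"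
  by (auto simp: base_graph_def atLeastAtMost_3_4)

lemma simple_base_graph: "simple_graph base_graph"
  by (auto simp: simple_graph_def base_graph_def)

lemma neighbors_base_graph:
  "neighbors base_graph (X 1) = {Y 1, Y 2, Y 3, Y 4}"
  "neighbors base_graph (X 2) = {Y 1, Y 2, Y 3, Y 4}"
  "neighbors base_graph (X 3) = {Y 1, Y 2, Y 3, Y 4}"
  "neighbors base_graph (Y 1) = {X 1, X 2, X 3, Y 2}"
  "neighbors base_graph (Y 2) = {X 1, X 2, X 3, Y 1}"
  "neighbors base_graph (Y 3) = {X 1, X 2, X 3, Y 4}"
  "neighbors base_graph (Y 4) = {X 1, X 2, X 3, Y 3}"
  by (auto simp: neighbors_def base_graph_def doubleton_eq_iff atLeastAtMost_3_4)

text \<open>The simplifier turns the index \<open>1\<close> into \<open>Suc 0\<close>; in this form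
  the equations still match.\<close>

lemmas base_neighbors = neighbors_base_graph[unfolded One_nat_def]

lemma regular_base_graph: "regular_graph 4 base_graph"
  by (simp add: regular_graph_def vertices_base_graph base_neighbors)

lemma CD_base_graph: "CD_0_infinity base_graph"
proof -
  have "Gamma2 base_graph f f v \<ge> 0" if v: "v \<in> vertices base_graph" for f v
  proof -
    \<comment> \<open>Four times Gamma2 as a sum of squares, with \<open>a\<close> the value at the
      vertex, \<open>b\<close>, \<open>c\<close> at the other two \<open>X\<close> vertices and
      \<open>p\<close>, \<open>q\<close>, \<open>r\<close>, \<open>s\<close> at the \<open>Y\<close>
      vertices. The first squares come from completing the square in the values at distance two:
      they have the form \<open>(k * t - 2 * S)^2 / k\<close>, where \<open>t\<close> is the
      increment to such a vertex, \<open>k\<close> the number of common neighbours (here 4) and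
      \<open>S\<close> the sum of the increments to these.\<close>
    define QX where "QX a b c p q r s = ((2 * (b - a) - (p + q + r + s - 4 * a))\<^sup>2
        + (2 * (c - a) - (p + q + r + s - 4 * a))\<^sup>2 + 4 * (p - q)\<^sup>2 + 4 * (r - s)\<^sup>2
        + 5 * ((p - a)\<^sup>2 + (q - a)\<^sup>2 + (r - a)\<^sup>2 + (s - a)\<^sup>2)) / 4" for a b c p q r s :: real
    \<comment> \<open>The same at a \<open>Y\<close> vertex with value \<open>p\<close>:
      \<open>q\<close> belongs to its \<open>Y\<close> neighbour, \<open>a\<close>,
      \<open>b\<close>, \<open>c\<close> to the \<open>X\<close> vertices, and \<open>r\<close>,
      \<open>s\<close> to the two vertices at distance two, now with \<open>k = 3\<close> common
      neighbours.\<close>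
    define QY where "QY a b c p q r s = ((3 * (r - p) - 2 * (a + b + c - 3 * p))\<^sup>2 / 3
        + (3 * (s - p) - 2 * (a + b + c - 3 * p))\<^sup>2 / 3
        + 2 * ((a - q)\<^sup>2 + (b - q)\<^sup>2 + (c - q)\<^sup>2) + 2 / 3 * ((a - b)\<^sup>2 + (a - c)\<^sup>2 + (b - c)\<^sup>2)
        + 5 * ((a - p)\<^sup>2 + (b - p)\<^sup>2 + (c - p)\<^sup>2) + 7 * (q - p)\<^sup>2) / 4" for a b c p q r s :: real
    have nonneg: "QX a b c p q r s \<ge> 0" "QY a b c p q r s \<ge> 0" for a b c p q r s
      by (simp_all add: QX_def QY_def)
    have X: "Gamma2 base_graph f f (X 1) = QX (f (X 1)) (f (X 2)) (f (X 3)) (f (Y 1)) (f (Y 2)) (f (Y 3)) (f (Y 4))"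
      "Gamma2 base_graph f f (X 2) = QX (f (X 2)) (f (X 1)) (f (X 3)) (f (Y 1)) (f (Y 2)) (f (Y 3)) (f (Y 4))"
      "Gamma2 base_graph f f (X 3) = QX (f (X 3)) (f (X 1)) (f (X 2)) (f (Y 1)) (f (Y 2)) (f (Y 3)) (f (Y 4))"
      by (simp add: Gamma2_eq_sum Gamma_eq_sum laplacian_def base_neighbors QX_def power2_eq_square,
          simp add: field_simps)+
    \<comment> \<open>The arguments are permuted by the symmetries of the graph that exchange
      \<open>Y\<close> vertices within a pair or exchange the two pairs.\<close>
    have Y: "Gamma2 base_graph f f (Y 1) = QY (f (X 1)) (f (X 2)) (f (X 3)) (f (Y 1)) (f (Y 2)) (f (Y 3)) (f (Y 4))"
      "Gamma2 base_graph f f (Y 2) = QY (f (X 1)) (f (X 2)) (f (X 3)) (f (Y 2)) (f (Y 1)) (f (Y 3)) (f (Y 4))"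
      "Gamma2 base_graph f f (Y 3) = QY (f (X 1)) (f (X 2)) (f (X 3)) (f (Y 3)) (f (Y 4)) (f (Y 1)) (f (Y 2))"
      "Gamma2 base_graph f f (Y 4) = QY (f (X 1)) (f (X 2)) (f (X 3)) (f (Y 4)) (f (Y 3)) (f (Y 1)) (f (Y 2))"
      by (simp add: Gamma2_eq_sum Gamma_eq_sum laplacian_def base_neighbors QY_def power2_eq_square,
          simp add: field_simps)+
    from v show ?thesis
      unfolding vertices_base_graph by (elim insertE emptyE) (simp_all only: X Y nonneg)
  qed
  then show ?thesis
    by (simp add: CD_0_infinity_def simple_base_graph regular_imp_locally_finite[OF regular_base_graph])
qed

text \<open>The neighbours of \<open>X 1\<close> span two edges, \<open>Y 1 Y 2\<close> and
  \<open>Y 3 Y 4\<close>; those of \<open>Y 1\<close> span three, from \<open>Y 2\<close> to each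
  \<open>X\<close> vertex. Orientation doubles both counts.\<close>

lemma card_triangles_at_base_graph:
  "card (triangles_at base_graph (X 1)) = 4" "card (triangles_at base_graph (Y 1)) = 6"
proof -
  have "triangles_at base_graph (X 1) = {(Y 1, Y 2), (Y 2, Y 1), (Y 3, Y 4), (Y 4, Y 3)}"
    by (auto simp: triangles_at_def base_neighbors)
  then show "card (triangles_at base_graph (X 1)) = 4" by simp
  have "triangles_at base_graph (Y 1)
      = {(X 1, Y 2), (X 2, Y 2), (X 3, Y 2), (Y 2, X 1), (Y 2, X 2), (Y 2, X 3)}"
    by (auto simp: triangles_at_def base_neighbors)
  then show "card (triangles_at base_graph (Y 1)) = 6" by simp
qed

section \<open>The family\<close>

lemma card_vertices_example_graph: "card (vertices (example_graph n)) = 7 * n"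
  by (simp add: example_graph_def vertices_base_graph card_cartesian_product cycle_graph_def)

lemma example_graph_not_cayley:
  assumes "n \<ge> 3"
  shows "\<not> is_cayley_graph TYPE('g) (example_graph n)"
proof
  note simple = simple_base_graph simple_cycle_graph[OF assms]
  note lf = regular_imp_locally_finite[OF regular_base_graph]
    regular_imp_locally_finite[OF regular_cycle_graph[OF assms]]
  have 0: "0 \<in> vertices (cycle_graph n)" using assms by (simp add: cycle_graph_def)
  have XY: "X 1 \<in> vertices base_graph" "Y 1 \<in> vertices base_graph"
    by (simp_all add: vertices_base_graph)
  assume "is_cayley_graph TYPE('g) (example_graph n)"
  then have "card (triangles_at (example_graph n) (X 1, 0)) = card (triangles_at (example_graph n) (Y 1, 0))"
    using 0 XY simple
    by (intro is_cayley_graph_card_triangles_at) (simp_all add: example_graph_def simple_graph_cartesian_product)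
  \<comment> \<open>The cycle contributes equally to both sides, also for \<open>n = 3\<close> where
    it is itself a triangle, so it cancels and \<open>4 = 6\<close> remains.\<close>
  then show False
    using card_triangles_at_cartesian_product[OF simple lf _ 0] XY card_triangles_at_base_graph
    by (simp add: example_graph_def)
qed

theorem mainTheorem12:
  shows "simple_graph base_graph \<and> card (vertices base_graph) = 7 \<and> regular_graph 4 base_graph
    \<and> infinite (example_graph ` {3..})
    \<and> strict_mono_on {3..} (\<lambda>n. card (vertices (example_graph n)))
    \<and> (\<forall>n\<ge>3. simple_graph (example_graph n) \<and> finite (vertices (example_graph n))
          \<and> regular_graph 6 (example_graph n)
          \<and> CD_0_infinity (example_graph n)
          \<and> \<not> is_cayley_graph TYPE('g) (example_graph n))"
proof (intro conjI allI impI)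
  show "simple_graph base_graph" by (rule simple_base_graph)
  show "card (vertices base_graph) = 7" by (simp add: vertices_base_graph)
  show "regular_graph 4 base_graph" by (rule regular_base_graph)
  \<comment> \<open>The number of vertices, \<open>7 * n\<close>, determines
    \<open>n\<close>.\<close>
  have "inj_on example_graph {3..}"
    by (rule inj_onI) (metis card_vertices_example_graph mult_left_cancel zero_neq_numeral)
  then show "infinite (example_graph ` {3..})"
    using finite_imageD infinite_Ici by blast
  show "strict_mono_on {3..} (\<lambda>n. card (vertices (example_graph n)))"
    by (simp add: card_vertices_example_graph strict_mono_on_def)
  fix n :: nat assume n: "n \<ge> 3"
  show "simple_graph (example_graph n)"
    using n by (simp add: example_graph_def simple_graph_cartesian_product simple_base_graph simple_cycle_graph)
  show "finite (vertices (example_graph n))"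
    by (simp add: example_graph_def vertices_base_graph cycle_graph_def)
  show "regular_graph 6 (example_graph n)"
    using regular_graph_cartesian_product[OF simple_base_graph simple_cycle_graph[OF n]
        regular_base_graph regular_cycle_graph[OF n]]
    by (simp add: example_graph_def)
  show "CD_0_infinity (example_graph n)"
    using n by (simp add: example_graph_def CD_0_infinity_cartesian_product CD_base_graph CD_cycle_graph)
  show "\<not> is_cayley_graph TYPE('g) (example_graph n)"
    using n by (rule example_graph_not_cayley)
qed

end
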